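(* For every finite simple connected graph $G$, $\gamma_{\mathrm{os}}(\mathscr{P}_4(G))=2\gamma(G)$.
   Context: For a poset $P=(X,\le)$, $\mathrm{Mid}(P)$ is the set of elements that are neither maximal nor minimal. The comparability graph $\mathrm{Comp}(P)$ has vertex set $X$, with $x\neq y$ adjacent iff $x<y$ or $y<x$. A dominating set of a graph is a set $S$ of vertices such that every vertex not in $S$ has a neighbor in $S$; $\gamma(G)$ is the minimum size of a dominating set of $G$. An order-sensitive dominating set of $P$ is a dominating set $D$ of $\mathrm{Comp}(P)$ such that for every $x\in\mathrm{Mid}(P)$, either $x\in D$ or there are $a,b\in D$ with $a<x<b$. $\gamma_{\mathrm{os}}(P)$ is the minimum size of an order-sensitive dominating set of $P$. For a graph $G$ on vertex set $[n]=\{1,\dots,n\}$ ($n\ge1$) and an integer $k\ge 2$, $\mathscr{P}_k(G)$ is the graded poset with ground set $\{x_{(l,i)} : l\in[k],\ i\in[n]\}$ whose covering relations are: for $r\in[k-1]$ and $i,j\in[n]$, $x_{(r,i)}\prec x_{(r+1,j)}$ iff $i=j$ or $ij\in E(G)$. *)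

theory Defs
  imports "Graph_Theory.Graph_Theory"
begin

text \<open>
  A simple graph is a \<^locale>\<open>pair_graph\<close>: a finite, loop-free digraph with a symmetric set of
  arcs, so an edge \<open>uv\<close> is the pair of arcs \<open>(u, v)\<close>, \<open>(v, u)\<close>.
  A poset is a carrier \<open>X\<close> with a reflexive order relation \<open>r\<close>, \<^term>\<open>partial_order_on X r\<close>;
  the strict order is \<^term>\<open>r - Id\<close>.
\<close>

definition dominating_set :: "'a pair_pre_digraph \<Rightarrow> 'a set \<Rightarrow> bool" where
  "dominating_set G S \<longleftrightarrow>
     S \<subseteq> pverts G \<and> (\<forall>v \<in> pverts G - S. \<exists>u \<in> S. (v, u) \<in> parcs G)"

text \<open>Finiteness is required because \<^const>\<open>card\<close> is 0 on infinite sets.\<close>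

definition domination_number :: "'a pair_pre_digraph \<Rightarrow> nat" where
  "domination_number G = (LEAST m. \<exists>S. dominating_set G S \<and> finite S \<and> card S = m)"

definition minimal_elems :: "'a set \<Rightarrow> 'a rel \<Rightarrow> 'a set" where
  "minimal_elems X r = {x \<in> X. \<not> (\<exists>y \<in> X. (y, x) \<in> r - Id)}"

definition maximal_elems :: "'a set \<Rightarrow> 'a rel \<Rightarrow> 'a set" where
  "maximal_elems X r = {x \<in> X. \<not> (\<exists>y \<in> X. (x, y) \<in> r - Id)}"

definition Mid :: "'a set \<Rightarrow> 'a rel \<Rightarrow> 'a set" where
  "Mid X r = X - (minimal_elems X r \<union> maximal_elems X r)"

definition Comp :: "'a set \<Rightarrow> 'a rel \<Rightarrow> 'a pair_pre_digraph" where
  "Comp X r = \<lparr> pverts = X,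
     parcs = {(x, y) \<in> X \<times> X. (x, y) \<in> r - Id \<or> (y, x) \<in> r - Id} \<rparr>"

definition os_dominating_set :: "'a set \<Rightarrow> 'a rel \<Rightarrow> 'a set \<Rightarrow> bool" where
  "os_dominating_set X r D \<longleftrightarrow> dominating_set (Comp X r) D \<and>
     (\<forall>x \<in> Mid X r. x \<in> D \<or> (\<exists>a \<in> D. \<exists>b \<in> D. (a, x) \<in> r - Id \<and> (x, b) \<in> r - Id))"

definition os_domination_number :: "'a set \<Rightarrow> 'a rel \<Rightarrow> nat" where
  "os_domination_number X r = (LEAST m. \<exists>D. os_dominating_set X r D \<and> finite D \<and> card D = m)"

text \<open>
  The graded poset \<open>\<P>\<^sub>k(G)\<close>: the element \<open>x\<^bsub>(l,i)\<^esub>\<close> is the pair \<open>(l, i)\<close>, and the order is the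
  reflexive transitive closure, on the ground set, of the prescribed covering relation.
\<close>

definition layer_ground :: "nat \<Rightarrow> 'a pair_pre_digraph \<Rightarrow> (nat \<times> 'a) set" where
  "layer_ground k G = {1..k} \<times> pverts G"

definition layer_cover :: "nat \<Rightarrow> 'a pair_pre_digraph \<Rightarrow> (nat \<times> 'a) rel" where
  "layer_cover k G = {((r, i), (r + 1, j)) | r i j.
     r \<in> {1..k - 1} \<and> i \<in> pverts G \<and> j \<in> pverts G \<and> (i = j \<or> (i, j) \<in> parcs G)}"

definition layer_order :: "nat \<Rightarrow> 'a pair_pre_digraph \<Rightarrow> (nat \<times> 'a) rel" where
  "layer_order k G = Id_on (layer_ground k G) \<union> (layer_cover k G)\<^sup>+"

lemma layer_cover_subset: "layer_cover k G \<subseteq> layer_ground k G \<times> layer_ground k G"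
  by (auto simp: layer_cover_def layer_ground_def)

lemma layer_cover_fst: "(x, y) \<in> layer_cover k G \<Longrightarrow> fst y = Suc (fst x)"
  by (auto simp: layer_cover_def)

lemma layer_cover_trancl_fst: "(x, y) \<in> (layer_cover k G)\<^sup>+ \<Longrightarrow> fst x < fst y"
  by (induction rule: trancl_induct) (auto dest: layer_cover_fst)

lemma layer_order_strict: "layer_order k G - Id = (layer_cover k G)\<^sup>+"
  by (auto simp: layer_order_def dest: layer_cover_trancl_fst)

lemma partial_order_on_layer_order: "partial_order_on (layer_ground k G) (layer_order k G)"
proof -
  have "(layer_cover k G)\<^sup>+ \<subseteq> layer_ground k G \<times> layer_ground k G"
    by (rule trancl_subset_Sigma[OF layer_cover_subset])
  then have "layer_order k G \<subseteq> layer_ground k G \<times> layer_ground k G"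
    and "refl_on (layer_ground k G) (layer_order k G)"
    by (auto simp: layer_order_def refl_on_def)
  moreover have "trans (layer_order k G)"
    by (auto simp: layer_order_def trans_def dest: trancl_trans)
  moreover have "antisym (layer_order k G)"
    by (auto simp: layer_order_def antisym_def dest!: layer_cover_trancl_fst)
  ultimately show ?thesis
    by (simp add: partial_order_on_def preorder_on_def)
qed

text \<open>The covering relation of the generated order is exactly the prescribed one.\<close>

lemma layer_cover_iff_covers:
  "(x, y) \<in> layer_cover k G \<longleftrightarrow> (x, y) \<in> layer_order k G - Id \<and>
     \<not> (\<exists>z. (x, z) \<in> layer_order k G - Id \<and> (z, y) \<in> layer_order k G - Id)"
  (is "?L \<longleftrightarrow> ?R")
proof
  assume ?L
  then show ?R
    unfolding layer_order_strict by (auto dest: layer_cover_fst dest!: layer_cover_trancl_fst)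
next
  assume ?R
  then show ?L
    unfolding layer_order_strict by (metis r_into_trancl' tranclE)
qed

end

theory Submission
  imports Defs
begin

text \<open>
  If \<open>S\<close> dominates \<open>G\<close>, then two copies of \<open>S\<close>, one in the bottom layer and one in the top layer,
  form an order-sensitive dominating set. Conversely, an element \<open>x\<^bsub>(2,i)\<^esub>\<close> outside an
  order-sensitive dominating set \<open>D\<close> must lie above an element of \<open>D\<close> in layer 1, which can only be
  some \<open>x\<^bsub>(1,j)\<^esub>\<close> with \<open>j\<close> in the closed neighbourhood of \<open>i\<close>; so the part of \<open>D\<close> in the two bottom
  layers projects onto a dominating set of \<open>G\<close>. Dually for the two top layers. When \<open>k \<ge> 4\<close> these
  parts are disjoint, whence \<open>card D \<ge> 2\<gamma>(G)\<close>.
\<close>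

lemma domination_number_le:
  assumes "dominating_set G S" "finite S"
  shows "domination_number G \<le> card S"
  unfolding domination_number_def by (rule Least_le) (use assms in blast)

text \<open>The full vertex set dominates, so for finite \<open>G\<close> the \<open>LEAST\<close>
  in \<open>domination_number\<close> is attained.\<close>

lemma obtain_minimum_dominating_set:
  assumes "finite (pverts G)"
  obtains S where "dominating_set G S" "finite S" "card S = domination_number G"
proof -
  have "\<exists>S. dominating_set G S \<and> finite S \<and> card S = card (pverts G)"
    using assms by (intro exI[of _ "pverts G"]) (auto simp: dominating_set_def)
  then have "\<exists>S. dominating_set G S \<and> finite S \<and> card S = domination_number G"
    unfolding domination_number_def by (rule LeastI)
  then show thesis using that by blast
qed

lemma os_domination_number_eqI:
  assumes "os_dominating_set X r D" "finite D" "card D = m"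
    and "\<And>D. os_dominating_set X r D \<Longrightarrow> finite D \<Longrightarrow> m \<le> card D"
  shows "os_domination_number X r = m"
  unfolding os_domination_number_def by (rule Least_equality) (use assms in blast)+

text \<open>The first cover, out of layer \<open>l\<close>, moves from \<open>i\<close> to
  \<open>j\<close>; all later covers climb within the column of \<open>j\<close>.\<close>

lemma layer_cover_trancl_chain:
  assumes "1 \<le> l" "Suc l \<le> m" "m \<le> k" "i \<in> pverts G" "j \<in> pverts G" "i = j \<or> (i, j) \<in> parcs G"
  shows "((l, i), (m, j)) \<in> (layer_cover k G)\<^sup>+"
  using assms(2,3)
proof (induction m rule: dec_induct)
  case base
  then show ?case using assms by (intro r_into_trancl) (auto simp: layer_cover_def)
next
  case (step m)
  then have "((m, j), (Suc m, j)) \<in> layer_cover k G"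
    using assms by (auto simp: layer_cover_def)
  then show ?case using step by (meson Suc_leD trancl_into_trancl)
qed

text \<open>Each cover raises the layer by exactly one, so a chain between consecutive layers is a
  single cover.\<close>

lemma layer_cover_trancl_consecutive:
  assumes "((l, i), (Suc l, j)) \<in> (layer_cover k G)\<^sup>+"
  shows "i \<in> pverts G \<and> j \<in> pverts G \<and> (i = j \<or> (i, j) \<in> parcs G)"
proof -
  have "((l, i), (Suc l, j)) \<in> layer_cover k G"
    using assms
  proof (cases rule: tranclE)
    case (step z)
    \<comment> \<open>In a longer chain the penultimate element \<open>z\<close> would lie in layer
      \<open>l\<close> and also strictly above it.\<close>
    then have "fst z = l" "l < fst z"
      by (auto dest: layer_cover_fst layer_cover_trancl_fst)
    then show ?thesis by simp
  qed
  then show ?thesis by (auto simp: layer_cover_def)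
qed

lemma layer_cover_trancl_ground:
  "(x, y) \<in> (layer_cover k G)\<^sup>+ \<Longrightarrow> x \<in> layer_ground k G \<and> y \<in> layer_ground k G"
  using trancl_subset_Sigma[OF layer_cover_subset[of k G]] by blast

text \<open>The strict order raises the layer, so elements of layers 1 and \<open>k\<close> are
  extremal; any other element has its own column below and above it.\<close>

lemma Mid_layer_order:
  "Mid (layer_ground k G) (layer_order k G) = {1<..<k} \<times> pverts G" (is "?M = _")
proof
  show "?M \<subseteq> {1<..<k} \<times> pverts G"
  proof
    fix x assume "x \<in> ?M"
    then obtain y z where "x \<in> layer_ground k G" "y \<in> layer_ground k G" "z \<in> layer_ground k G"
      "fst y < fst x" "fst x < fst z"
      unfolding Mid_def minimal_elems_def maximal_elems_def layer_order_strict
      using layer_cover_trancl_fst by blast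
    then show "x \<in> {1<..<k} \<times> pverts G"
      by (auto simp: layer_ground_def)
  qed
  show "{1<..<k} \<times> pverts G \<subseteq> ?M"
  proof clarify
    fix l i assume l: "l \<in> {1<..<k}" and i: "i \<in> pverts G"
    then have "((1, i), (l, i)) \<in> (layer_cover k G)\<^sup>+" "((l, i), (k, i)) \<in> (layer_cover k G)\<^sup>+"
      by (auto intro: layer_cover_trancl_chain)
    moreover have "(l, i) \<in> layer_ground k G"
      using l i by (auto simp: layer_ground_def)
    ultimately show "(l, i) \<in> ?M"
      unfolding Mid_def minimal_elems_def maximal_elems_def layer_order_strict
      using layer_cover_trancl_ground by blast
  qed
qed

context pair_graph
begin

lemma os_dominating_set_two_copies:
  assumes k: "2 \<le> k" and S: "dominating_set G S"
  shows "os_dominating_set (layer_ground k G) (layer_order k G) ({1, k} \<times> S)"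
proof -
  let ?R = "(layer_cover k G)\<^sup>+"
  have sub: "S \<subseteq> pverts G" using S by (simp add: dominating_set_def)
  have near: "\<exists>j \<in> S. j \<in> pverts G \<and> (i = j \<or> (i, j) \<in> parcs G) \<and> (j = i \<or> (j, i) \<in> parcs G)"
    if "i \<in> pverts G" for i
    using S that arcs_symmetric unfolding dominating_set_def by blast
  have below: "\<exists>a \<in> {1, k} \<times> S. (a, (l, i)) \<in> ?R" if "1 < l" "l \<le> k" "i \<in> pverts G" for l i
    using near[OF that(3)] that layer_cover_trancl_chain[of 1 l k _ G i] by fastforce
  have above: "\<exists>b \<in> {1, k} \<times> S. ((l, i), b) \<in> ?R" if "1 \<le> l" "l < k" "i \<in> pverts G" for l i
    using near[OF that(3)] that layer_cover_trancl_chain[of l k k i G] by fastforce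
  have "\<exists>u \<in> {1, k} \<times> S. ((l, i), u) \<in> ?R \<or> (u, (l, i)) \<in> ?R"
    if "(l, i) \<in> layer_ground k G" for l i
  \<comment> \<open>Layer 1 is dominated by the top copy, which differs from it as
    \<open>2 \<le> k\<close>; all other layers by the bottom copy.\<close>
  proof (cases "l = 1")
    case True
    then show ?thesis using above[of l i] that k by (auto simp: layer_ground_def)
  next
    case False
    then show ?thesis using below[of l i] that by (auto simp: layer_ground_def)
  qed
  moreover have "{1, k} \<times> S \<subseteq> layer_ground k G"
    using sub k by (auto simp: layer_ground_def)
  ultimately have "dominating_set (Comp (layer_ground k G) (layer_order k G)) ({1, k} \<times> S)"
    unfolding dominating_set_def Comp_def layer_order_strict by fastforce
  moreover have "\<exists>a \<in> {1, k} \<times> S. \<exists>b \<in> {1, k} \<times> S. (a, x) \<in> ?R \<and> (x, b) \<in> ?R"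
    if "x \<in> {1<..<k} \<times> pverts G" for x
    using below[of "fst x" "snd x"] above[of "fst x" "snd x"] that by fastforce
  ultimately show ?thesis
    unfolding os_dominating_set_def Mid_layer_order layer_order_strict by blast
qed

text \<open>The set \<open>L\<close> of layers is a parameter so that the argument serves both the
  two bottom and the two top layers.\<close>

lemma dominating_set_projection:
  assumes D: "D \<subseteq> layer_ground k G"
    and near: "\<And>i. i \<in> pverts G \<Longrightarrow> \<exists>l \<in> L. \<exists>j. (l, j) \<in> D \<and> (i = j \<or> (i, j) \<in> parcs G)"
  shows "dominating_set G (snd ` (D \<inter> L \<times> UNIV))"
  unfolding dominating_set_def
proof (intro conjI ballI)
  show "snd ` (D \<inter> L \<times> UNIV) \<subseteq> pverts G"
    using D by (auto simp: layer_ground_def)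
  fix i assume i: "i \<in> pverts G - snd ` (D \<inter> L \<times> UNIV)"
  then obtain l j where "l \<in> L" "(l, j) \<in> D" "i = j \<or> (i, j) \<in> parcs G"
    using near by blast
  then have "j \<in> snd ` (D \<inter> L \<times> UNIV)" by force
  then show "\<exists>j \<in> snd ` (D \<inter> L \<times> UNIV). (i, j) \<in> parcs G"
    using i \<open>i = j \<or> (i, j) \<in> parcs G\<close> by auto
qed

lemma domination_number_le_card_os_dominating_set:
  assumes k: "4 \<le> k" and fin: "finite D"
    and os: "os_dominating_set (layer_ground k G) (layer_order k G) D"
  shows "2 * domination_number G \<le> card D"
proof -
  let ?R = "(layer_cover k G)\<^sup>+"
  have D: "D \<subseteq> layer_ground k G"
    using os by (auto simp: os_dominating_set_def dominating_set_def Comp_def)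
  have mid: "(l, i) \<in> D \<or> (\<exists>a \<in> D. (a, (l, i)) \<in> ?R) \<and> (\<exists>b \<in> D. ((l, i), b) \<in> ?R)"
    if "1 < l" "l < k" "i \<in> pverts G" for l i
    using os that unfolding os_dominating_set_def Mid_layer_order layer_order_strict by force
  have "\<exists>l \<in> {1, 2}. \<exists>j. (l, j) \<in> D \<and> (i = j \<or> (i, j) \<in> parcs G)" if i: "i \<in> pverts G" for i
  proof (cases "(2, i) \<in> D")
    case False
    then obtain l j where a: "(l, j) \<in> D" "((l, j), (2, i)) \<in> ?R"
      using mid[of 2 i] i k by auto
    then have "l = 1"
      using D layer_cover_trancl_fst[OF a(2)] by (auto simp: layer_ground_def)
    then have "j = i \<or> (j, i) \<in> parcs G"
      using a layer_cover_trancl_consecutive[of 1 j i k G] by (simp add: numeral_2_eq_2)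
    \<comment> \<open>The chain upwards yields the arc \<open>(j, i)\<close>; domination asks for
      the reversed arc.\<close>
    then show ?thesis
      using a \<open>l = 1\<close> arcs_symmetric by blast
  qed auto
  then have low: "dominating_set G (snd ` (D \<inter> {1, 2} \<times> UNIV))"
    by (rule dominating_set_projection[OF D])
  have "\<exists>l \<in> {k - 1, k}. \<exists>j. (l, j) \<in> D \<and> (i = j \<or> (i, j) \<in> parcs G)" if i: "i \<in> pverts G" for i
  proof (cases "(k - 1, i) \<in> D")
    case False
    moreover have "1 < k - 1" "k - 1 < k" using k by auto
    ultimately obtain l j where b: "(l, j) \<in> D" "((k - 1, i), (l, j)) \<in> ?R"
      using mid[of "k - 1" i] i by auto
    \<comment> \<open>The second form of \<open>l\<close> lets the lemma on consecutive layers
      apply.\<close>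
    then have l: "l = k" "l = Suc (k - 1)"
      using D layer_cover_trancl_fst[OF b(2)] by (auto simp: layer_ground_def)
    then show ?thesis
      using b layer_cover_trancl_consecutive[of "k - 1" i j k G] by auto
  qed auto
  then have high: "dominating_set G (snd ` (D \<inter> {k - 1, k} \<times> UNIV))"
    by (rule dominating_set_projection[OF D])
  \<comment> \<open>Projecting to \<open>G\<close> cannot increase cardinality, so the bound passes
    back to the layers of \<open>D\<close>.\<close>
  have "domination_number G \<le> card (D \<inter> L \<times> UNIV)"
    if "dominating_set G (snd ` (D \<inter> L \<times> UNIV))" for L
    using domination_number_le[OF that] fin card_image_le[of "D \<inter> L \<times> UNIV" snd] by fastforce
  from this[OF low] this[OF high]
  have "2 * domination_number G \<le> card (D \<inter> {1, 2} \<times> UNIV) + card (D \<inter> {k - 1, k} \<times> UNIV)"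
    by simp
  \<comment> \<open>Here \<open>4 \<le> k\<close> gives \<open>2 < k - 1\<close>, so the two pairs
    of layers are disjoint.\<close>
  also have "\<dots> = card (D \<inter> {1, 2} \<times> UNIV \<union> D \<inter> {k - 1, k} \<times> UNIV)"
    using fin k by (intro card_Un_disjoint[symmetric]) auto
  also have "\<dots> \<le> card D"
    using fin by (intro card_mono) auto
  finally show ?thesis .
qed

lemma os_domination_number_layer_order:
  assumes "4 \<le> k"
  shows "os_domination_number (layer_ground k G) (layer_order k G) = 2 * domination_number G"
proof -
  obtain S where S: "dominating_set G S" "finite S" "card S = domination_number G"
    using obtain_minimum_dominating_set finite_verts by blast
  show ?thesis
  proof (rule os_domination_number_eqI)
    show "os_dominating_set (layer_ground k G) (layer_order k G) ({1, k} \<times> S)"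
      using assms S by (intro os_dominating_set_two_copies) auto
    \<comment> \<open>The factor 2 is the size of \<open>{1, k}\<close>, as \<open>k\<close> differs
      from 1.\<close>
    show "finite ({1, k} \<times> S)" "card ({1, k} \<times> S) = 2 * domination_number G"
      using assms S by (auto simp: card_cartesian_product)
  qed (use assms domination_number_le_card_os_dominating_set in blast)
qed

end

theorem theorem15:
  fixes G :: "'a pair_pre_digraph"
  assumes "pair_graph G"
    and "Digraph_Component.connected (with_proj G)"
  shows "os_domination_number (layer_ground 4 G) (layer_order 4 G) = 2 * domination_number G"
  using assms(1) by (rule pair_graph.os_domination_number_layer_order) simp

end
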